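(* Let $d\ge1$ be an integer and let $c>0$ be an integer with the $d$-binomial expansion $c=\binom{c_d}{d}+\cdots+\binom{c_i}{i}$, $c_d>\cdots>c_i\geq i\geq 1$. The following statements are equivalent: (a) $c^{(d)}=0$. (b) $c\leq d$.
   Context: For a positive integer $a$ with $d$-binomial expansion $a=\binom{a_d}{d}+\binom{a_{d-1}}{d-1}+\cdots+\binom{a_j}{j}$, $a_d>a_{d-1}>\cdots>a_j\geq j\geq1$ (which exists and is unique), one sets $a^{(d)}=\binom{a_d}{d+1}+\binom{a_{d-1}}{d}+\cdots+\binom{a_j}{j+1}$. *)

theory Defs
  imports Main
begin

text \<open>
  A \<open>d\<close>-binomial expansion of \<open>c\<close> is given by its lowest index \<open>j\<close> and a function \<open>a\<close> of
  which only the values at \<open>j, \<dots>, d\<close> matter. Since \<open>a\<close> is increasing there, the chain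
  \<open>a d > \<dots> > a j \<ge> j \<ge> 1\<close> bounds each \<open>a k\<close> below by \<open>k\<close>.
\<close>
definition binomial_expansion :: "nat \<Rightarrow> nat \<Rightarrow> nat \<Rightarrow> (nat \<Rightarrow> nat) \<Rightarrow> bool" where
  "binomial_expansion d c j a \<longleftrightarrow>
     1 \<le> j \<and> j \<le> d \<and> j \<le> a j \<and> strict_mono_on {j..d} a \<and>
     c = (\<Sum>k=j..d. a k choose k)"

text \<open>
  The operation \<open>c\<^sup>(\<^sup>d\<^sup>)\<close>. The description is justified for \<open>d, c > 0\<close> by the existence and
  uniqueness of the expansion, shown below; it is not meaningful otherwise.
\<close>
definition binomial_shift :: "nat \<Rightarrow> nat \<Rightarrow> nat" where
  "binomial_shift d c =
     (THE b. \<exists>j a. binomial_expansion d c j a \<and> b = (\<Sum>k=j..d. a k choose (k + 1)))"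

lemma binomial_expansion_single:
  "1 \<le> d \<Longrightarrow> d \<le> n \<Longrightarrow> binomial_expansion d (n choose d) d (\<lambda>_. n)"
  by (auto simp: binomial_expansion_def strict_mono_on_def)

lemma binomial_expansion_Suc:
  assumes "j \<le> d"
  shows "binomial_expansion (Suc d) c j a \<longleftrightarrow>
    a d < a (Suc d) \<and> (\<exists>r. binomial_expansion d r j a \<and> c = r + (a (Suc d) choose Suc d))"
proof -
  have "strict_mono_on {j..Suc d} a \<longleftrightarrow> strict_mono_on {j..d} a \<and> a d < a (Suc d)"
  proof
    assume "strict_mono_on {j..Suc d} a"
    then show "strict_mono_on {j..d} a \<and> a d < a (Suc d)"
      using assms by (auto simp: strict_mono_on_def)
  next
    assume *: "strict_mono_on {j..d} a \<and> a d < a (Suc d)"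
    have "a x < a y" if "x \<in> {j..Suc d}" "y \<in> {j..Suc d}" "x < y" for x y
    proof (cases "y = Suc d")
      case True
      then have "x = d \<or> a x < a d"
        using * that assms unfolding strict_mono_on_def
        by (metis True atLeastAtMost_iff le_refl less_Suc_eq less_Suc_eq_le)
      then show ?thesis using True * by auto
    next
      case False
      then show ?thesis using * that by (auto simp: strict_mono_on_def)
    qed
    then show "strict_mono_on {j..Suc d} a" by (auto simp: strict_mono_on_def)
  qed
  then show ?thesis
    using assms by (auto simp: binomial_expansion_def)
qed

lemma binomial_expansion_lower:
  assumes "binomial_expansion d c j a"
  shows "(a d choose d) \<le> c"
  using assms member_le_sum[of d "{j..d}" "\<lambda>k. a k choose k"]
  by (auto simp: binomial_expansion_def)

lemma binomial_expansion_top: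
  assumes "binomial_expansion d c j a"
  shows "d \<le> a d"
  using assms
proof (induction d arbitrary: c)
  case 0
  then show ?case by simp
next
  case (Suc d)
  show ?case
  proof (cases "j = Suc d")
    case True
    then show ?thesis using Suc.prems by (auto simp: binomial_expansion_def)
  next
    case False
    then have "j \<le> d" using Suc.prems by (auto simp: binomial_expansion_def)
    then show ?thesis using Suc binomial_expansion_Suc[of j d c a] by fastforce
  qed
qed

lemma binomial_expansion_upper:
  assumes "binomial_expansion d c j a"
  shows "c < (Suc (a d) choose d)"
  using assms
proof (induction d arbitrary: c)
  case 0
  then show ?case by (auto simp: binomial_expansion_def)
next
  case (Suc d)
  show ?case
  proof (cases "j = Suc d")
    case True
    then have "c = (a (Suc d) choose Suc d)" "Suc d \<le> a (Suc d)"
      using Suc.prems by (auto simp: binomial_expansion_def)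
    then show ?thesis by (simp add: zero_less_binomial_iff)
  next
    case False
    then have "j \<le> d" using Suc.prems by (auto simp: binomial_expansion_def)
    then obtain r where r: "binomial_expansion d r j a" "a d < a (Suc d)"
        "c = r + (a (Suc d) choose Suc d)"
      using Suc.prems binomial_expansion_Suc by blast
    have "r < (Suc (a d) choose d)" using Suc.IH r(1) .
    also have "\<dots> \<le> (a (Suc d) choose d)"
      using r(2) by (intro binomial_right_mono) auto
    finally show ?thesis using r(3) by simp
  qed
qed

lemma binomial_expansion_exists:
  assumes "1 \<le> d" "0 < c"
  shows "\<exists>j a. binomial_expansion d c j a"
  using assms
proof (induction d arbitrary: c)
  case 0
  then show ?case by simp
next
  case (Suc d)
  have bound: "n \<le> c + d" if "(n choose Suc d) \<le> c" for n
  proof (rule ccontr)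
    assume "\<not> n \<le> c + d"
    then have "(Suc (c + d) choose Suc d) \<le> (n choose Suc d)"
      by (intro binomial_right_mono) auto
    moreover have "Suc c \<le> (Suc (c + d) choose Suc d)"
    proof (induction c)
      case (Suc c)
      moreover have "0 < (Suc (c + d) choose d)" by (rule zero_less_binomial) simp
      moreover have "(Suc (Suc c + d) choose Suc d) =
          (Suc (c + d) choose d) + (Suc (c + d) choose Suc d)"
        by (simp only: add_Suc binomial_Suc_Suc)
      ultimately show ?case by linarith
    qed simp
    ultimately show False using that by linarith
  qed
  define n where "n = (GREATEST n. (n choose Suc d) \<le> c)"
  have ex: "(Suc d choose Suc d) \<le> c" using Suc.prems by simp
  have n1: "(n choose Suc d) \<le> c" and n3: "Suc d \<le> n"
    unfolding n_def
    using GreatestI_nat[of "\<lambda>n. (n choose Suc d) \<le> c" "Suc d" "c + d"]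
      Greatest_le_nat[of "\<lambda>n. (n choose Suc d) \<le> c" "Suc d" "c + d"] ex bound by auto
  have n2: "c < (Suc n choose Suc d)"
    using Greatest_le_nat[of "\<lambda>n. (n choose Suc d) \<le> c" "Suc n" "c + d"] bound
    unfolding n_def[symmetric] by (meson not_less not_less_eq_eq order_refl)
  show ?case
  proof (cases "c = (n choose Suc d)")
    case True
    then show ?thesis using binomial_expansion_single[of "Suc d" n] n3 by auto
  next
    case False
    define r where "r = c - (n choose Suc d)"
    have r: "0 < r" "c = r + (n choose Suc d)" "r < (n choose d)"
      using False n1 n2 unfolding r_def by auto
    have d: "1 \<le> d" using r by (cases d) auto
    then obtain j a where ja: "binomial_expansion d r j a"
      using Suc.IH r(1) by blast
    have "(a d choose d) < (n choose d)"
      using binomial_expansion_lower[OF ja] r(3) by linarith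
    then have "a d < n" using binomial_right_mono[of n "a d" d] by (meson not_less)
    have "j \<le> d" using ja by (simp add: binomial_expansion_def)
    let ?a = "a(Suc d := n)"
    have "binomial_expansion d r j ?a"
      using ja by (auto simp: binomial_expansion_def strict_mono_on_def)
    then have "binomial_expansion (Suc d) c j ?a"
      using binomial_expansion_Suc[OF \<open>j \<le> d\<close>] \<open>a d < n\<close> r(2) by auto
    then show ?thesis by blast
  qed
qed

lemma binomial_expansion_unique:
  assumes "binomial_expansion d c j a" "binomial_expansion d c j' a'"
  shows "j = j' \<and> (\<forall>k\<in>{j..d}. a k = a' k)"
  using assms
proof (induction d arbitrary: c)
  case 0
  then show ?case by (auto simp: binomial_expansion_def)
next
  case (Suc d)
  have le: "b (Suc d) \<le> b' (Suc d)"
    if "binomial_expansion (Suc d) c i b" "binomial_expansion (Suc d) c i' b'" for i i' b b'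
  proof (rule ccontr)
    assume "\<not> ?thesis"
    then have "(Suc (b' (Suc d)) choose Suc d) \<le> (b (Suc d) choose Suc d)"
      by (intro binomial_right_mono) auto
    then show False
      using binomial_expansion_lower[OF that(1)] binomial_expansion_upper[OF that(2)] by linarith
  qed
  have top: "a (Suc d) = a' (Suc d)" using le Suc.prems by (meson order_antisym)
  have low: "(b (Suc d) choose Suc d) < c \<and> i \<le> d"
    if i: "binomial_expansion (Suc d) c i b" "i \<noteq> Suc d" for i b
  proof -
    have "i \<le> d" using i by (auto simp: binomial_expansion_def)
    then obtain r where r: "binomial_expansion d r i b" "c = r + (b (Suc d) choose Suc d)"
      using i binomial_expansion_Suc by blast
    have "0 < (b d choose d)" using binomial_expansion_top[OF r(1)] by simp
    then show ?thesis using binomial_expansion_lower[OF r(1)] r(2) \<open>i \<le> d\<close> by linarith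
  qed
  have eq: "c = (b (Suc d) choose Suc d)"
    if "binomial_expansion (Suc d) c (Suc d) b" for b
    using that by (auto simp: binomial_expansion_def)
  show ?case
  proof (cases "j = Suc d \<or> j' = Suc d")
    case True
    then have "j = Suc d \<and> j' = Suc d"
      using low eq top Suc.prems by (metis less_irrefl)
    then show ?thesis using top by auto
  next
    case False
    then have jd: "j \<le> d" "j' \<le> d" using low Suc.prems by blast+
    obtain r r' where r: "binomial_expansion d r j a" "c = r + (a (Suc d) choose Suc d)"
        "binomial_expansion d r' j' a'" "c = r' + (a' (Suc d) choose Suc d)"
      using Suc.prems jd binomial_expansion_Suc by blast
    then have "r' = r" using top by simp
    then show ?thesis using Suc.IH r top by (metis atLeastAtMost_iff le_Suc_eq)
  qed
qed

lemma binomial_shift_eq: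
  assumes "binomial_expansion d c j a"
  shows "binomial_shift d c = (\<Sum>k=j..d. a k choose (k + 1))"
  unfolding binomial_shift_def
proof (rule the_equality)
  show "\<exists>j' a'. binomial_expansion d c j' a' \<and>
      (\<Sum>k=j..d. a k choose (k + 1)) = (\<Sum>k=j'..d. a' k choose (k + 1))"
    using assms by blast
next
  fix b
  assume "\<exists>j' a'. binomial_expansion d c j' a' \<and> b = (\<Sum>k=j'..d. a' k choose (k + 1))"
  then obtain j' a' where *: "binomial_expansion d c j' a'"
      "b = (\<Sum>k=j'..d. a' k choose (k + 1))" by blast
  show "b = (\<Sum>k=j..d. a k choose (k + 1))"
    using binomial_expansion_unique[OF assms *(1)] *(2) by (auto intro: sum.cong)
qed

end

theory Submission
  imports Defs
begin

text \<open>
  Both conditions say that the top entry of the expansion satisfies \<open>a d \<le> d\<close>.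

  On the one hand, \<open>c\<close> lies in the interval from \<open>a d choose d\<close> up to, but excluding,
  \<open>a d + 1 choose d\<close> (\<open>binomial_expansion_lower\<close>, \<open>binomial_expansion_upper\<close>). The value
  \<open>d + 1 choose d = d + 1\<close> is an endpoint of two such intervals, so \<open>c \<le> d\<close> exactly when
  \<open>a d \<le> d\<close> (\<open>le_degree_iff_top_le_degree\<close>).

  On the other hand, the shift is a sum of natural numbers, so it vanishes iff each
  \<open>a k choose (k + 1)\<close> does, that is, iff \<open>a k \<le> k\<close> for all \<open>k\<close>. Because \<open>a\<close> is strictly
  increasing on integers, the excess \<open>a k - k\<close> never decreases with \<open>k\<close>
  (\<open>strict_mono_on_excess\<close>), so it is enough that this holds for \<open>k = d\<close>.
\<close>

lemma strict_mono_on_excess: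
  fixes a :: "nat \<Rightarrow> nat"
  assumes "strict_mono_on {i..d} a" "i \<le> k" "k \<le> d"
  shows "a k + d \<le> a d + k"
  using assms(3,1,2)
proof (induction d rule: dec_induct)
  case base
  then show ?case by simp
next
  case (step n)
  then have "a k + n \<le> a n + k"
    by (auto simp: strict_mono_on_def)
  moreover have "a n < a (Suc n)"
    using step.prems step.hyps by (auto simp: strict_mono_on_def)
  ultimately show ?case by linarith
qed

lemma le_degree_iff_top_le_degree:
  assumes "binomial_expansion d c i a"
  shows "c \<le> d \<longleftrightarrow> a d \<le> d"
proof
  assume "c \<le> d"
  show "a d \<le> d"
  proof (rule ccontr)
    assume "\<not> a d \<le> d"
    then have "(Suc d choose d) \<le> (a d choose d)"
      by (intro binomial_right_mono) simp
    with \<open>c \<le> d\<close> binomial_expansion_lower[OF assms] show False by simp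
  qed
next
  assume "a d \<le> d"
  then have "(Suc (a d) choose d) \<le> (Suc d choose d)"
    by (intro binomial_right_mono) simp
  with binomial_expansion_upper[OF assms] show "c \<le> d" by simp
qed

lemma binomial_shift_eq_0_iff_top_le_degree:
  assumes "binomial_expansion d c i a"
  shows "binomial_shift d c = 0 \<longleftrightarrow> a d \<le> d"
proof -
  have mono: "strict_mono_on {i..d} a" and "i \<le> d"
    using assms by (auto simp: binomial_expansion_def)
  have "binomial_shift d c = 0 \<longleftrightarrow> (\<forall>k\<in>{i..d}. a k \<le> k)"
    by (simp add: binomial_shift_eq[OF assms] binomial_eq_0_iff less_Suc_eq_le)
  also have "\<dots> \<longleftrightarrow> a d \<le> d"
    using strict_mono_on_excess[OF mono] \<open>i \<le> d\<close> by fastforce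
  finally show ?thesis .
qed

theorem lemma1p2p54:
  fixes d c i :: nat and a :: "nat \<Rightarrow> nat"
  assumes "d \<ge> 1" and "c > 0"
    and "binomial_expansion d c i a"
  shows "binomial_shift d c = 0 \<longleftrightarrow> c \<le> d"
  using binomial_shift_eq_0_iff_top_le_degree[OF assms(3)]
    le_degree_iff_top_le_degree[OF assms(3)] by simp

end
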